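(* Let $\mathbf{k}$ be a field, $\lambda\in\mathbf{k}$, and let $(\mathfrak{g},P_{\mathfrak{g}})$ be a Rota-Baxter Lie algebra of weight $\lambda$. Let $E$ be a vector space containing $\mathfrak{g}$ as a subspace and let $(E,[-,-],P_E)$ be a Rota-Baxter Lie algebra of weight $\lambda$ such that $(\mathfrak{g},P_{\mathfrak{g}})$ is a Rota-Baxter Lie subalgebra of $(E,[-,-],P_E)$. Then there exist a subspace $V$ of $E$ which is a complement of $\mathfrak{g}$ in $E$, a Rota-Baxter Lie extending structure $\Omega((\mathfrak{g},P_{\mathfrak{g}}),V)=(\triangleleft,\triangleright,f,\{-,-\},P_1,P_2)$ of $(\mathfrak{g},P_{\mathfrak{g}})$ through $V$, and an isomorphism of Rota-Baxter Lie algebras $\phi:(\mathfrak{g}\natural V,\mathcal{P})\to(E,P_E)$ that stabilizes $(\mathfrak{g},P_{\mathfrak{g}})$ and co-stabilizes $V$.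
   Context: All vector spaces, linear and bilinear maps are over the field $\mathbf{k}$; $\lambda\in\mathbf{k}$ is fixed. A Rota-Baxter Lie algebra (of weight $\lambda$) is a Lie algebra $\mathfrak{g}$ with a linear map $P:\mathfrak{g}\to\mathfrak{g}$ such that $[P(g),P(h)]=P([P(g),h]+[g,P(h)]+\lambda[g,h])$ for all $g,h\in\mathfrak{g}$. A morphism $(\mathfrak{g},P)\to(\mathfrak{g}',P')$ is a Lie algebra morphism $\phi$ with $\phi\circ P=P'\circ\phi$; it is an isomorphism if it is bijective. $(\mathfrak{g},P_{\mathfrak{g}})$ is a Rota-Baxter Lie subalgebra of $(E,[-,-],P_E)$ if $\mathfrak{g}\subseteq E$ is a subspace, the bracket of $E$ restricts to that of $\mathfrak{g}$, and $P_E|_{\mathfrak{g}}=P_{\mathfrak{g}}$. Extending datum: for a vector space $V$, an extending datum of $(\mathfrak{g},P_{\mathfrak{g}})$ through $V$ is a system $(\triangleleft,\triangleright,f,\{-,-\},P_1,P_2)$ of bilinear maps $\triangleleft:V\times\mathfrak{g}\to V$, $\triangleright:V\times\mathfrak{g}\to\mathfrak{g}$, $f:V\times V\to\mathfrak{g}$, $\{-,-\}:V\times V\to V$ and linear maps $P_1:V\to\mathfrak{g}$, $P_2:V\to V$. Given such a datum, $\mathfrak{g}\natural V$ denotes the vector space $\mathfrak{g}\times V$ with $$[(g,x),(h,y)]:=([g,h]+x\triangleright h-y\triangleright g+f(x,y),\ \{x,y\}+x\triangleleft h-y\triangleleft g),$$ $$\mathcal{P}((g,x)):=(P_{\mathfrak{g}}(g)+P_1(x),\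 P_2(x)).$$ The datum is called a Rota-Baxter Lie extending structure of $(\mathfrak{g},P_{\mathfrak{g}})$ through $V$ if $\mathfrak{g}\natural V$ with these maps is a Rota-Baxter Lie algebra of weight $\lambda$ (then called the unified product). A complement of $\mathfrak{g}$ in $E$ is a subspace $V$ with $E=\mathfrak{g}+V$ and $\mathfrak{g}\cap V=0$. A linear map $\phi:\mathfrak{g}\natural V\to E$ stabilizes $(\mathfrak{g},P_{\mathfrak{g}})$ if $\phi(g,0)=g$ for all $g\in\mathfrak{g}$, and co-stabilizes $V$ if $\pi(\phi(g,x))=x$ for all $g\in\mathfrak{g},x\in V$, where $\pi:E=\mathfrak{g}+V\to V$ is the canonical projection. *)

theory Defs
  imports "HOL-Analysis.Product_Vector"
begin

text \<open>
  Vector spaces are subspaces (carrier sets) of an ambient space given by the library locale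
  \<open>vector_space\<close>; a whole type is the case \<open>UNIV\<close>. Maps are total HOL functions of which only the
  values on the carriers matter.
\<close>

definition linear_on ::
  "('k::field \<Rightarrow> 'a::ab_group_add \<Rightarrow> 'a) \<Rightarrow> ('k \<Rightarrow> 'b::ab_group_add \<Rightarrow> 'b) \<Rightarrow>
   'a set \<Rightarrow> 'b set \<Rightarrow> ('a \<Rightarrow> 'b) \<Rightarrow> bool" where
  "linear_on sA sB A B f \<longleftrightarrow>
     (\<forall>x\<in>A. f x \<in> B) \<and>
     (\<forall>x\<in>A. \<forall>y\<in>A. f (x + y) = f x + f y) \<and>
     (\<forall>c. \<forall>x\<in>A. f (sA c x) = sB c (f x))"

definition bilinear_on ::
  "('k::field \<Rightarrow> 'a::ab_group_add \<Rightarrow> 'a) \<Rightarrow> ('k \<Rightarrow> 'b::ab_group_add \<Rightarrow> 'b) \<Rightarrow>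
   ('k \<Rightarrow> 'c::ab_group_add \<Rightarrow> 'c) \<Rightarrow>
   'a set \<Rightarrow> 'b set \<Rightarrow> 'c set \<Rightarrow> ('a \<Rightarrow> 'b \<Rightarrow> 'c) \<Rightarrow> bool" where
  "bilinear_on sA sB sC A B C f \<longleftrightarrow>
     (\<forall>x\<in>A. linear_on sB sC B C (f x)) \<and>
     (\<forall>y\<in>B. linear_on sA sC A C (\<lambda>x. f x y))"

text \<open>The alternating law is required rather than antisymmetry, since the characteristic may be 2.\<close>

locale lie_algebra = vector_space scale
  for scale :: "'k::field \<Rightarrow> 'a::ab_group_add \<Rightarrow> 'a" +
  fixes L :: "'a set" and br :: "'a \<Rightarrow> 'a \<Rightarrow> 'a"
  assumes carrier_subspace: "module.subspace scale L"
    and bracket_bilinear: "bilinear_on scale scale scale L L L br"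
    and bracket_alternating: "x \<in> L \<Longrightarrow> br x x = 0"
    and jacobi: "x \<in> L \<Longrightarrow> y \<in> L \<Longrightarrow> z \<in> L \<Longrightarrow>
      br x (br y z) + br y (br z x) + br z (br x y) = 0"

locale rota_baxter_lie_algebra = lie_algebra scale L br
  for scale :: "'k::field \<Rightarrow> 'a::ab_group_add \<Rightarrow> 'a" and wt :: 'k
    and L :: "'a set" and br :: "'a \<Rightarrow> 'a \<Rightarrow> 'a" +
  fixes P :: "'a \<Rightarrow> 'a"
  assumes operator_linear: "linear_on scale scale L L P"
    and rota_baxter: "g \<in> L \<Longrightarrow> h \<in> L \<Longrightarrow>
      br (P g) (P h) = P (br (P g) h + br g (P h) + scale wt (br g h))"

locale rota_baxter_lie_hom =
  dom: rota_baxter_lie_algebra s wt L br P + cod: rota_baxter_lie_algebra s' wt L' br' P'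
  for s :: "'k::field \<Rightarrow> 'a::ab_group_add \<Rightarrow> 'a" and s' :: "'k \<Rightarrow> 'b::ab_group_add \<Rightarrow> 'b"
    and wt :: 'k
    and L :: "'a set" and br :: "'a \<Rightarrow> 'a \<Rightarrow> 'a" and P :: "'a \<Rightarrow> 'a"
    and L' :: "'b set" and br' :: "'b \<Rightarrow> 'b \<Rightarrow> 'b" and P' :: "'b \<Rightarrow> 'b" +
  fixes \<phi> :: "'a \<Rightarrow> 'b"
  assumes hom_linear: "linear_on s s' L L' \<phi>"
    and hom_bracket: "x \<in> L \<Longrightarrow> y \<in> L \<Longrightarrow> \<phi> (br x y) = br' (\<phi> x) (\<phi> y)"
    and hom_operator: "x \<in> L \<Longrightarrow> \<phi> (P x) = P' (\<phi> x)"

locale rota_baxter_lie_iso = rota_baxter_lie_hom +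
  assumes bijective: "bij_betw \<phi> L L'"

definition rota_baxter_lie_subalgebra ::
  "('k::field \<Rightarrow> 'a::ab_group_add \<Rightarrow> 'a) \<Rightarrow>
   'a set \<Rightarrow> ('a \<Rightarrow> 'a \<Rightarrow> 'a) \<Rightarrow> ('a \<Rightarrow> 'a) \<Rightarrow>
   'a set \<Rightarrow> ('a \<Rightarrow> 'a \<Rightarrow> 'a) \<Rightarrow> ('a \<Rightarrow> 'a) \<Rightarrow> bool" where
  "rota_baxter_lie_subalgebra s G brG PG E brE PE \<longleftrightarrow>
     module.subspace s G \<and> G \<subseteq> E \<and>
     (\<forall>g\<in>G. \<forall>h\<in>G. brE g h = brG g h) \<and>
     (\<forall>g\<in>G. PE g = PG g)"

record ('g, 'v) datum =
  ract :: "'v \<Rightarrow> 'g \<Rightarrow> 'v"   (* \<triangleleft> *)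
  lact :: "'v \<Rightarrow> 'g \<Rightarrow> 'g"   (* \<triangleright> *)
  cocycle :: "'v \<Rightarrow> 'v \<Rightarrow> 'g"   (* f *)
  vbracket :: "'v \<Rightarrow> 'v \<Rightarrow> 'v"   (* {-,-} *)
  op1 :: "'v \<Rightarrow> 'g"   (* P_1 *)
  op2 :: "'v \<Rightarrow> 'v"   (* P_2 *)

definition extending_datum ::
  "('k::field \<Rightarrow> 'g::ab_group_add \<Rightarrow> 'g) \<Rightarrow> ('k \<Rightarrow> 'v::ab_group_add \<Rightarrow> 'v) \<Rightarrow>
   'g set \<Rightarrow> 'v set \<Rightarrow> ('g, 'v) datum \<Rightarrow> bool" where
  "extending_datum sG sV G V \<Omega> \<longleftrightarrow>
     bilinear_on sV sG sV V G V (ract \<Omega>) \<and>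
     bilinear_on sV sG sG V G G (lact \<Omega>) \<and>
     bilinear_on sV sV sG V V G (cocycle \<Omega>) \<and>
     bilinear_on sV sV sV V V V (vbracket \<Omega>) \<and>
     linear_on sV sG V G (op1 \<Omega>) \<and>
     linear_on sV sV V V (op2 \<Omega>)"

fun unified_bracket ::
  "('g::ab_group_add \<Rightarrow> 'g \<Rightarrow> 'g) \<Rightarrow> ('g, 'v::ab_group_add) datum \<Rightarrow>
   'g \<times> 'v \<Rightarrow> 'g \<times> 'v \<Rightarrow> 'g \<times> 'v" where
  "unified_bracket brG \<Omega> (g, x) (h, y) =
     (brG g h + lact \<Omega> x h - lact \<Omega> y g + cocycle \<Omega> x y,
      vbracket \<Omega> x y + ract \<Omega> x h - ract \<Omega> y g)"

fun unified_operator ::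
  "('g::ab_group_add \<Rightarrow> 'g) \<Rightarrow> ('g, 'v) datum \<Rightarrow> 'g \<times> 'v \<Rightarrow> 'g \<times> 'v" where
  "unified_operator PG \<Omega> (g, x) = (PG g + op1 \<Omega> x, op2 \<Omega> x)"

text \<open>The unified product lives on the carrier \<open>G \<times> V\<close> with componentwise vector space structure.\<close>

locale rota_baxter_lie_extending_structure =
  rota_baxter_lie_algebra sG wt G brG PG + V: vector_space sV
  for sG :: "'k::field \<Rightarrow> 'g::ab_group_add \<Rightarrow> 'g" and sV :: "'k \<Rightarrow> 'v::ab_group_add \<Rightarrow> 'v"
    and wt :: 'k
    and G :: "'g set" and brG :: "'g \<Rightarrow> 'g \<Rightarrow> 'g" and PG :: "'g \<Rightarrow> 'g" +
  fixes V :: "'v set" and \<Omega> :: "('g, 'v) datum"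
  assumes V_subspace: "module.subspace sV V"
    and datum: "extending_datum sG sV G V \<Omega>"
    and unified_product: "rota_baxter_lie_algebra (module_prod.scale sG sV) wt (G \<times> V)
      (unified_bracket brG \<Omega>) (unified_operator PG \<Omega>)"

definition is_complement ::
  "('k::field \<Rightarrow> 'a::ab_group_add \<Rightarrow> 'a) \<Rightarrow> 'a set \<Rightarrow> 'a set \<Rightarrow> 'a set \<Rightarrow> bool" where
  "is_complement s E G V \<longleftrightarrow>
     module.subspace s V \<and> V \<subseteq> E \<and>
     E = {g + x |g x. g \<in> G \<and> x \<in> V} \<and> G \<inter> V = {0}"

definition canonical_projection ::
  "'a::ab_group_add set \<Rightarrow> 'a set \<Rightarrow> 'a \<Rightarrow> 'a" where
  "canonical_projection G V e = (THE x. x \<in> V \<and> (\<exists>g\<in>G. e = g + x))"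

definition stabilizes :: "'a set \<Rightarrow> ('a \<times> 'a::ab_group_add \<Rightarrow> 'a) \<Rightarrow> bool" where
  "stabilizes G \<phi> \<longleftrightarrow> (\<forall>g\<in>G. \<phi> (g, 0) = g)"

definition co_stabilizes ::
  "'a set \<Rightarrow> 'a set \<Rightarrow> ('a \<times> 'a::ab_group_add \<Rightarrow> 'a) \<Rightarrow> bool" where
  "co_stabilizes G V \<phi> \<longleftrightarrow>
     (\<forall>g\<in>G. \<forall>x\<in>V. canonical_projection G V (\<phi> (g, x)) = x)"

end

theory Submission
  imports Defs
begin

text \<open>A linear projection \<open>q\<close> of the ambient space onto \<open>G\<close> has kernel \<open>V\<close> in \<open>E\<close> complementary to
  \<open>G\<close>. Splitting the bracket and the operator of \<open>E\<close> into their \<open>G\<close>- and \<open>V\<close>-components gives the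
  extending datum, and addition is then a linear bijection from \<open>G \<times> V\<close> to \<open>E\<close> compatible with
  bracket and operator, along which all the axioms are pulled back from \<open>E\<close>.\<close>

lemma linear_onD:
  assumes "linear_on sA sB A B f"
  shows "x \<in> A \<Longrightarrow> f x \<in> B"
    and "x \<in> A \<Longrightarrow> y \<in> A \<Longrightarrow> f (x + y) = f x + f y"
    and "x \<in> A \<Longrightarrow> f (sA c x) = sB c (f x)"
  using assms by (auto simp: linear_on_def)

lemma bilinear_onD:
  assumes "bilinear_on sA sB sC A B C f"
  shows "x \<in> A \<Longrightarrow> y \<in> B \<Longrightarrow> f x y \<in> C"
    and "x \<in> A \<Longrightarrow> y \<in> B \<Longrightarrow> y' \<in> B \<Longrightarrow> f x (y + y') = f x y + f x y'"
    and "x \<in> A \<Longrightarrow> y \<in> B \<Longrightarrow> f x (sB c y) = sC c (f x y)"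
    and "x \<in> A \<Longrightarrow> x' \<in> A \<Longrightarrow> y \<in> B \<Longrightarrow> f (x + x') y = f x y + f x' y"
    and "x \<in> A \<Longrightarrow> y \<in> B \<Longrightarrow> f (sA c x) y = sC c (f x y)"
  using assms by (auto simp: bilinear_on_def linear_on_def)

lemma linear_on_subset:
  "linear_on sA sB A B f \<Longrightarrow> A' \<subseteq> A \<Longrightarrow> linear_on sA sB A' B f"
  by (auto simp: linear_on_def subset_iff)

lemma linear_on_comp:
  "linear_on sA sB A B f \<Longrightarrow> linear_on sB sC B C h \<Longrightarrow> linear_on sA sC A C (\<lambda>x. h (f x))"
  by (auto simp: linear_on_def)

lemma bilinear_on_subset:
  "bilinear_on sA sB sC A B C f \<Longrightarrow> A' \<subseteq> A \<Longrightarrow> B' \<subseteq> B \<Longrightarrow> bilinear_on sA sB sC A' B' C f"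
  by (auto simp: bilinear_on_def linear_on_def subset_iff)

lemma bilinear_on_comp:
  "bilinear_on sA sB sC A B C f \<Longrightarrow> linear_on sC sD C D h \<Longrightarrow>
    bilinear_on sA sB sD A B D (\<lambda>x y. h (f x y))"
  by (auto simp: bilinear_on_def linear_on_def)

text \<open>Polarisation: expanding the alternating law at \<open>x + y\<close> leaves only the two
  mixed terms. This argument works in every characteristic.\<close>

lemma (in lie_algebra) bracket_antisym:
  assumes x: "x \<in> L" and y: "y \<in> L"
  shows "br x y = - br y x"
proof -
  note [simp] = bilinear_onD[OF bracket_bilinear]
  have "x + y \<in> L"
    using carrier_subspace x y by (rule subspace_add)
  then have "br (x + y) (x + y) = 0" by (rule bracket_alternating)
  then have "br x y + br y x = 0"
    using x y bracket_alternating[OF x] bracket_alternating[OF y] \<open>x + y \<in> L\<close>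
    by (simp add: add.commute)
  then show ?thesis by (rule eq_neg_iff_add_eq_0[THEN iffD2])
qed

text \<open>Every axiom on \<open>M\<close> is an equation between elements of \<open>M\<close>. Its
  image under \<phi> is the corresponding axiom on \<open>L\<close>, and injectivity brings it
  back.\<close>

lemma (in rota_baxter_lie_algebra) pullback:
  assumes vs: "vector_space s'"
    and sub: "module.subspace s' M"
    and lin: "linear_on s' scale M L \<phi>"
    and inj: "inj_on \<phi> M"
    and br_closed: "\<And>x y. x \<in> M \<Longrightarrow> y \<in> M \<Longrightarrow> br' x y \<in> M"
    and P_closed: "\<And>x. x \<in> M \<Longrightarrow> P' x \<in> M"
    and hom: "\<And>x y. x \<in> M \<Longrightarrow> y \<in> M \<Longrightarrow> \<phi> (br' x y) = br (\<phi> x) (\<phi> y)"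
    and op: "\<And>x. x \<in> M \<Longrightarrow> \<phi> (P' x) = P (\<phi> x)"
  shows "rota_baxter_lie_algebra s' wt M br' P'"
proof -
  interpret M: vector_space s' by (rule vs)
  note closed = br_closed P_closed M.subspace_add[OF sub] M.subspace_scale[OF sub]
    M.subspace_0[OF sub]
  \<comment> \<open>Needed because the alternating law and the Jacobi identity have right-hand side
    \<open>0\<close>.\<close>
  have \<phi>0: "\<phi> 0 = 0"
    using linear_onD(2)[OF lin, of 0 0] M.subspace_0[OF sub] by simp
  note \<phi> = linear_onD[OF lin] hom op \<phi>0
  note eqI = inj_onD[OF inj]
  note br = bilinear_onD[OF bracket_bilinear] and P = linear_onD[OF operator_linear]
  \<comment> \<open>Even bilinearity of \<open>br'\<close> is inherited through injectivity; only
    closure of \<open>M\<close> under it is assumed.\<close>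
  have bilin: "bilinear_on s' s' s' M M M br'"
    unfolding bilinear_on_def linear_on_def
    by (intro conjI ballI allI eqI) (simp_all add: closed \<phi> br)
  have lin': "linear_on s' s' M M P'"
    unfolding linear_on_def
    by (intro conjI ballI allI eqI) (simp_all add: closed \<phi> P)
  show ?thesis
  proof
    fix x y z assume xyz: "x \<in> M" "y \<in> M" "z \<in> M"
    show "br' x x = 0"
      using xyz by (intro eqI) (simp_all add: closed \<phi> bracket_alternating)
    show "br' x (br' y z) + br' y (br' z x) + br' z (br' x y) = 0"
      using xyz by (intro eqI) (simp_all add: closed \<phi> jacobi)
    show "br' (P' x) (P' y) = P' (br' (P' x) y + br' x (P' y) + s' wt (br' x y))"
      using xyz by (intro eqI) (simp_all add: closed \<phi> rota_baxter)
  qed (fact sub bilin lin')+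
qed

text \<open>The identity is linear and injective on \<open>G\<close>, so it has a linear left
  inverse there, defined on the whole space with values in \<open>G\<close>.\<close>

lemma (in vector_space) exists_projection_onto_subspace:
  assumes "subspace G"
  obtains q where "linear_on scale scale UNIV G q" and "\<And>g. g \<in> G \<Longrightarrow> q g = g"
proof -
  interpret vector_space_pair scale scale ..
  obtain q where "q ` UNIV \<subseteq> G" "Vector_Spaces.linear scale scale q" "\<forall>g\<in>G. q g = g"
    using linear_exists_left_inverse_on[of id G] assms by (auto simp: linear_id)
  then show thesis
    by (intro that[of q]) (auto simp: linear_on_def linear_add linear_scale)
qed

context
  fixes scale :: "'k::field \<Rightarrow> 'e::ab_group_add \<Rightarrow> 'e" and G E :: "'e set" and q :: "'e \<Rightarrow> 'e"
  assumes vs: "vector_space scale"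
    and G: "module.subspace scale G"
    and E: "module.subspace scale E"
    and GE: "G \<subseteq> E"
    and q_lin: "linear_on scale scale UNIV G q"
    and q_id: "\<And>g. g \<in> G \<Longrightarrow> q g = g"
begin

interpretation vector_space scale by (rule vs)

text \<open>Since \<open>q\<close> is linear on the whole ambient space and not just on
  \<open>E\<close>, these rules carry no membership conditions.\<close>

lemma q_add: "q (x + y) = q x + q y" and q_scale: "q (scale c x) = scale c (q x)"
  and q_mem: "q x \<in> G"
  using linear_onD[OF q_lin] by auto

lemma q_zero: "q 0 = 0"
  using q_id subspace_0[OF G] by blast

lemma q_diff: "q (x - y) = q x - q y"
  using q_add[of "x - y" y] by simp

lemma kernel_subspace: "subspace {x \<in> E. q x = 0}"
  by (rule subspaceI) (auto simp: q_add q_scale q_zero subspace_0[OF E] subspace_add[OF E]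
      subspace_scale[OF E])

text \<open>This is the projection of \<open>E\<close> onto the kernel along \<open>G\<close>:
  \<open>x - q x\<close> stays in \<open>E\<close> because \<open>G\<close> lies in
  \<open>E\<close>, and \<open>q\<close> kills it because \<open>q\<close> fixes
  \<open>q x\<close>.\<close>

lemma residual_linear: "linear_on scale scale E {x \<in> E. q x = 0} (\<lambda>x. x - q x)"
  unfolding linear_on_def
  using GE q_mem
  by (auto simp: q_add q_scale q_diff q_id algebra_simps scale_right_diff_distrib
      intro: subspace_diff[OF E])

lemma kernel_complement: "is_complement scale E G {x \<in> E. q x = 0}"
  unfolding is_complement_def
proof (intro conjI set_eqI iffI)
  fix e assume "e \<in> E"
  then show "e \<in> {g + x |g x. g \<in> G \<and> x \<in> {x \<in> E. q x = 0}}"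
    using linear_onD(1)[OF residual_linear] q_mem[of e]
    by (intro CollectI exI[of _ "q e"] exI[of _ "e - q e"]) auto
qed (use kernel_subspace GE q_id subspace_0[OF G] subspace_0[OF E] subspace_add[OF E] q_zero
    in auto)

text \<open>The inverse sends \<open>e\<close> to its two components \<open>q e\<close> and
  \<open>e - q e\<close>.\<close>

lemma kernel_sum_bij: "bij_betw (\<lambda>(g, x). g + x) (G \<times> {x \<in> E. q x = 0}) E"
  by (rule bij_betw_byWitness[where f' = "\<lambda>e. (q e, e - q e)"])
    (use linear_onD(1)[OF residual_linear] GE q_mem subspace_add[OF E] in \<open>auto simp: q_add q_id\<close>)

lemma kernel_canonical_projection:
  assumes "g \<in> G" "x \<in> E" "q x = 0"
  shows "canonical_projection G {x \<in> E. q x = 0} (g + x) = x"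
  unfolding canonical_projection_def
proof (rule the_equality)
  fix y assume "y \<in> {x \<in> E. q x = 0} \<and> (\<exists>h\<in>G. g + x = h + y)"
  then obtain h where h: "h \<in> G" "q y = 0" and eq: "g + x = h + y" by auto
  \<comment> \<open>Applying \<open>q\<close> to both decompositions fixes the
    \<open>G\<close>-parts and kills the kernel parts.\<close>
  have "g = h"
    using arg_cong[OF eq, of q] h assms by (simp add: q_add q_id)
  then show "y = x" using eq by simp
qed (use assms in auto)

end

theorem theorem2p11:
  fixes scale :: "'k::field \<Rightarrow> 'e::ab_group_add \<Rightarrow> 'e" and wt :: 'k
    and G E :: "'e set"
    and brG brE :: "'e \<Rightarrow> 'e \<Rightarrow> 'e" and PG PE :: "'e \<Rightarrow> 'e"
  assumes "rota_baxter_lie_algebra scale wt G brG PG"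
    and "rota_baxter_lie_algebra scale wt E brE PE"
    and "rota_baxter_lie_subalgebra scale G brG PG E brE PE"
  shows "\<exists>(V :: 'e set) (\<Omega> :: ('e, 'e) datum) (\<phi> :: 'e \<times> 'e \<Rightarrow> 'e).
    is_complement scale E G V \<and>
    rota_baxter_lie_extending_structure scale scale wt G brG PG V \<Omega> \<and>
    rota_baxter_lie_iso (module_prod.scale scale scale) scale wt
      (G \<times> V) (unified_bracket brG \<Omega>) (unified_operator PG \<Omega>) E brE PE \<phi> \<and>
    stabilizes G \<phi> \<and> co_stabilizes G V \<phi>"
proof -
  interpret G: rota_baxter_lie_algebra scale wt G brG PG by fact
  interpret E: rota_baxter_lie_algebra scale wt E brE PE by fact
  interpret prod: vector_space_prod scale scale ..
  have GE: "G \<subseteq> E" and brG: "\<And>g h. g \<in> G \<Longrightarrow> h \<in> G \<Longrightarrow> brE g h = brG g h"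
    and PG: "\<And>g. g \<in> G \<Longrightarrow> PE g = PG g"
    using assms(3) by (auto simp: rota_baxter_lie_subalgebra_def)
  obtain q where q_lin: "linear_on scale scale UNIV G q" and q_id: "\<And>g. g \<in> G \<Longrightarrow> q g = g"
    using G.exists_projection_onto_subspace[OF G.carrier_subspace] by metis
  note ctx = G.vector_space_axioms G.carrier_subspace E.carrier_subspace GE q_lin q_id
  define V where "V = {x \<in> E. q x = 0}"
  \<comment> \<open>For \<open>x\<close> in \<open>V\<close>, the map \<open>q\<close> extracts the
    \<open>G\<close>-component and \<open>id - q\<close> the \<open>V\<close>-component of
    \<open>brE x g\<close>, \<open>brE x y\<close> and \<open>PE x\<close>. Brackets with the
    \<open>V\<close>-element on the right need no separate entry: antisymmetry accounts for the
    minus signs in \<open>unified_bracket\<close>.\<close>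
  define \<Omega> :: "('e, 'e) datum" where "\<Omega> =
    \<lparr>ract = \<lambda>x g. brE x g - q (brE x g), lact = \<lambda>x g. q (brE x g),
     cocycle = \<lambda>x y. q (brE x y), vbracket = \<lambda>x y. brE x y - q (brE x y),
     op1 = \<lambda>x. q (PE x), op2 = \<lambda>x. PE x - q (PE x)\<rparr>"
  define \<phi> :: "'e \<times> 'e \<Rightarrow> 'e" where "\<phi> = (\<lambda>(g, x). g + x)"
  have V: "G.subspace V" and VE: "V \<subseteq> E"
    unfolding V_def using kernel_subspace[OF ctx] by auto
  have p_lin: "linear_on scale scale E V (\<lambda>x. x - q x)"
    unfolding V_def by (rule residual_linear[OF ctx])
  have q_linE: "linear_on scale scale E G q"
    by (rule linear_on_subset[OF q_lin]) simp
  \<comment> \<open>Each entry is \<open>brE\<close> or \<open>PE\<close>, restricted to the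
    carriers and followed by one of the two linear projections.\<close>
  have datum: "extending_datum scale scale G V \<Omega>"
    unfolding extending_datum_def \<Omega>_def
    by (simp add: GE VE bilinear_on_comp[OF _ p_lin] bilinear_on_comp[OF _ q_linE]
        bilinear_on_subset[OF E.bracket_bilinear]
        linear_on_comp[OF linear_on_subset[OF E.operator_linear VE] p_lin]
        linear_on_comp[OF linear_on_subset[OF E.operator_linear VE] q_linE])
  have \<Omega>: "bilinear_on scale scale scale V G V (ract \<Omega>)"
    "bilinear_on scale scale scale V G G (lact \<Omega>)"
    "bilinear_on scale scale scale V V G (cocycle \<Omega>)"
    "bilinear_on scale scale scale V V V (vbracket \<Omega>)"
    "linear_on scale scale V G (op1 \<Omega>)"
    "linear_on scale scale V V (op2 \<Omega>)"
    using datum by (auto simp: extending_datum_def)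
  note mem = \<Omega>(1-4)[THEN bilinear_onD(1)] \<Omega>(5-6)[THEN linear_onD(1)]
    bilinear_onD(1)[OF G.bracket_bilinear] linear_onD(1)[OF G.operator_linear]
    G.subspace_add[OF G.carrier_subspace] G.subspace_diff[OF G.carrier_subspace]
    G.subspace_add[OF V] G.subspace_diff[OF V]
  note brE = bilinear_onD[OF E.bracket_bilinear] and PE = linear_onD[OF E.operator_linear]
  have lin: "linear_on prod.scale scale (G \<times> V) E \<phi>"
    unfolding linear_on_def \<phi>_def using GE VE
    by (auto simp: G.scale_right_distrib prod.scale_def algebra_simps
        intro: G.subspace_add[OF E.carrier_subspace])
  have bij: "bij_betw \<phi> (G \<times> V) E"
    unfolding V_def \<phi>_def by (rule kernel_sum_bij[OF ctx])
  have hom: "\<phi> (unified_bracket brG \<Omega> a b) = brE (\<phi> a) (\<phi> b)"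
    if ab: "a \<in> G \<times> V" "b \<in> G \<times> V" for a b
  proof -
    obtain g x h y where [simp]: "a = (g, x)" "b = (h, y)" by (cases a, cases b)
    have G': "g \<in> G" "h \<in> G" and E': "g \<in> E" "h \<in> E" "x \<in> E" "y \<in> E"
      using ab GE VE by auto
    \<comment> \<open>Adding the two components cancels every term containing
      \<open>q\<close>.\<close>
    have "\<phi> (unified_bracket brG \<Omega> a b) = brE g h + brE x h - brE y g + brE x y"
      by (simp add: \<phi>_def \<Omega>_def brG[OF G'] algebra_simps)
    \<comment> \<open>Antisymmetry replaces \<open>- brE y g\<close> by the mixed term
      \<open>brE g y\<close> of the bilinear expansion.\<close>
    also have "\<dots> = brE (g + x) (h + y)"
      using E' by (simp add: brE G.subspace_add[OF E.carrier_subspace]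
          E.bracket_antisym[of g y] algebra_simps)
    finally show ?thesis by (simp add: \<phi>_def)
  qed
  have op: "\<phi> (unified_operator PG \<Omega> a) = PE (\<phi> a)" if "a \<in> G \<times> V" for a
    using that GE VE by (cases a) (auto simp: \<phi>_def \<Omega>_def PE PG subset_iff)
  have up: "rota_baxter_lie_algebra prod.scale wt (G \<times> V)
      (unified_bracket brG \<Omega>) (unified_operator PG \<Omega>)"
  \<comment> \<open>The unified product inherits all its axioms from \<open>E\<close> along \<phi>;
    closure of the carrier follows from the datum having values in \<open>G\<close> and
    \<open>V\<close>.\<close>
  proof (rule E.pullback[OF _ _ lin _ _ _ hom op])
    show "vector_space prod.scale" ..
    show "module.subspace prod.scale (G \<times> V)"
      by (rule prod.subspace_Times) (fact G.carrier_subspace V)+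
    show "inj_on \<phi> (G \<times> V)" using bij by (rule bij_betw_imp_inj_on)
  qed (auto simp: mem)
  have "is_complement scale E G V"
    unfolding V_def by (rule kernel_complement[OF ctx])
  moreover have "rota_baxter_lie_extending_structure scale scale wt G brG PG V \<Omega>"
    by (intro rota_baxter_lie_extending_structure.intro
        rota_baxter_lie_extending_structure_axioms.intro) (fact assms(1) ctx(1) V datum up)+
  moreover have "rota_baxter_lie_iso prod.scale scale wt
      (G \<times> V) (unified_bracket brG \<Omega>) (unified_operator PG \<Omega>) E brE PE \<phi>"
    by (intro rota_baxter_lie_iso.intro rota_baxter_lie_hom.intro
        rota_baxter_lie_hom_axioms.intro rota_baxter_lie_iso_axioms.intro)
      (fact up assms(2) lin hom op bij)+
  moreover have "stabilizes G \<phi>"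
    by (simp add: stabilizes_def \<phi>_def)
  moreover have "co_stabilizes G V \<phi>"
    unfolding co_stabilizes_def V_def \<phi>_def using kernel_canonical_projection[OF ctx] by auto
  ultimately show ?thesis by blast
qed

end
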